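(* For all integers $n\ge 0$ and $k\ge 1$, \[ \begin{cases} k\mid a(n+k)+a(n), & \text{if } k \text{ is odd},\\ k\mid a(n+k)-a(n), & \text{if } k\equiv 0,2,6\pmod 8,\\ k\mid 2\bigl(a(n+k)-a(n)\bigr), & \text{if } k\equiv 4\pmod 8. \end{cases} \]
   Context: For a positive integer $m$, $d(m)$ denotes the number of positive divisors of $m$. The integer sequence $(a(n))_{n\ge 0}$ (OEIS A028342) is defined by the following identity of formal power series in $\mathbb{Q}[[x]]$: \[ \sum_{n\ge 0} a(n)\frac{x^n}{n!}=\prod_{i\ge 1}(1-x^i)^{-1/i}=\exp\Bigl(\sum_{m\ge 1}\frac{d(m)\,x^m}{m}\Bigr). \] Equivalently, $a(n)=\sum_{\sigma}\prod_{C} d(|C|)$, where $\sigma$ ranges over all permutations of an $n$-element set and $C$ ranges over the cycles of $\sigma$ (fixed points count as cycles of length $1$). The first values are $a(0),a(1),\dots=1,1,3,11,59,339,2629,\dots$. *)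

theory Defs
  imports "HOL-Analysis.Analysis"
begin

definition num_divisors :: "nat \<Rightarrow> nat" where
  "num_divisors m = card {d. d dvd m}"

definition divisor_series :: "rat fps" where
  "divisor_series = Abs_fps (\<lambda>m. if m = 0 then 0 else of_nat (num_divisors m) / of_nat m)"

text \<open>The composition \<open>f oo g\<close> of formal power series is meaningful only if \<open>g\<close> has zero
  constant term, as \<open>divisor_series\<close> does; \<open>fps_exp 1\<close> is the series of \<open>exp x\<close>.\<close>

definition a_egf :: "rat fps" where
  "a_egf = fps_exp 1 oo divisor_series"

text \<open>The floor only converts the type: \<open>n!\<close> times the \<open>n\<close>-th coefficient is an integer, and
  \<open>a\<close> is the integer sequence with exponential generating function \<open>a_egf\<close>;
  see \<open>of_int_a\<close> and \<open>egf_a\<close> below.\<close>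

definition a :: "nat \<Rightarrow> int" where
  "a n = \<lfloor>fact n * fps_nth a_egf n\<rfloor>"

lemma divisor_series_nth_0 [simp]: "fps_nth divisor_series 0 = 0"
  by (simp add: divisor_series_def)

lemma a_egf_nth_0 [simp]: "fps_nth a_egf 0 = 1"
  by (simp add: a_egf_def)

lemma deriv_a_egf: "fps_deriv a_egf = fps_deriv divisor_series * a_egf"
  by (simp add: a_egf_def fps_compose_deriv mult.commute)

lemma a_egf_rec:
  "of_nat (Suc n) * fps_nth a_egf (Suc n) =
     (\<Sum>j\<le>n. of_nat (num_divisors (Suc j)) * fps_nth a_egf (n - j))"
proof -
  have "of_nat (Suc n) * fps_nth a_egf (Suc n) = fps_nth (fps_deriv a_egf) n"
    by simp
  also have "\<dots> = fps_nth (fps_deriv divisor_series * a_egf) n"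
    by (simp only: deriv_a_egf)
  also have "\<dots> = (\<Sum>j\<le>n. of_nat (num_divisors (Suc j)) * fps_nth a_egf (n - j))"
    unfolding fps_mult_nth atLeast0AtMost
    by (intro sum.cong refl) (simp add: divisor_series_def del: of_nat_Suc)
  finally show ?thesis .
qed

lemma a_egf_fact_rec:
  "fact (Suc n) * fps_nth a_egf (Suc n) =
     (\<Sum>j\<le>n. of_nat (num_divisors (Suc j) * (fact n div fact (n - j))) *
        (fact (n - j) * fps_nth a_egf (n - j)))"
proof -
  have "fact (Suc n) * fps_nth a_egf (Suc n) =
      fact n * (of_nat (Suc n) * fps_nth a_egf (Suc n))"
    by (simp add: mult_ac del: of_nat_Suc)
  also have "\<dots> = (\<Sum>j\<le>n. fact n * (of_nat (num_divisors (Suc j)) * fps_nth a_egf (n - j)))"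
    by (simp only: a_egf_rec sum_distrib_left)
  also have "\<dots> = (\<Sum>j\<le>n. of_nat (num_divisors (Suc j) * (fact n div fact (n - j))) *
        (fact (n - j) * fps_nth a_egf (n - j)))"
  proof (intro sum.cong refl)
    fix j assume "j \<in> {..n}"
    have "(fact n div fact (n - j)) * fact (n - j) = (fact n :: nat)"
      by (simp add: fact_dvd)
    hence "of_nat (fact n div fact (n - j)) * fact (n - j) = (fact n :: rat)"
      by (metis of_nat_fact of_nat_mult)
    thus "fact n * (of_nat (num_divisors (Suc j)) * fps_nth a_egf (n - j)) =
        of_nat (num_divisors (Suc j) * (fact n div fact (n - j))) *
        (fact (n - j) * fps_nth a_egf (n - j))"
      by (metis (no_types, lifting) mult.assoc mult.commute of_nat_mult)
  qed
  finally show ?thesis .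
qed

lemma a_egf_integral: "fact n * fps_nth a_egf n \<in> \<int>"
proof (induction n rule: less_induct)
  case (less n)
  show ?case
  proof (cases n)
    case (Suc m)
    show ?thesis
      unfolding Suc a_egf_fact_rec
      by (intro Ints_sum Ints_mult Ints_of_nat less) (simp add: Suc)
  qed simp
qed

lemma of_int_a: "of_int (a n) = fact n * fps_nth a_egf n"
  using a_egf_integral[of n] by (auto simp: a_def elim!: Ints_cases)

lemma egf_a: "Abs_fps (\<lambda>n. of_int (a n) / fact n) = a_egf"
  by (rule fps_ext) (simp add: of_int_a)

text \<open>The product formula \<open>\<Prod>i\<ge>1. (1 - x^i)^(-1/i)\<close>, where \<open>fps_binomial c\<close> is the binomial
  series of \<open>(1 + x)^c\<close>.\<close>

lemma fps_linear_ode_unique: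
  fixes A B G :: "rat fps"
  assumes "fps_deriv A = G * A" "fps_deriv B = G * B" "fps_nth A 0 = fps_nth B 0"
  shows "A = B"
proof (rule fps_ext)
  fix n show "fps_nth A n = fps_nth B n"
  proof (induction n rule: less_induct)
    case (less n)
    show ?case
    proof (cases n)
      case (Suc m)
      have "of_nat (Suc m) * fps_nth A (Suc m) = fps_nth (G * A) m"
        by (simp flip: assms(1))
      also have "\<dots> = fps_nth (G * B) m"
        unfolding fps_mult_nth by (intro sum.cong refl) (simp add: less Suc)
      also have "\<dots> = of_nat (Suc m) * fps_nth B (Suc m)"
        by (simp flip: assms(2))
      finally show ?thesis unfolding Suc by (simp del: of_nat_Suc)
    qed (simp add: assms)
  qed
qed

lemma exp_compose_add:
  fixes F G :: "rat fps"
  assumes "fps_nth F 0 = 0" "fps_nth G 0 = 0"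
  shows "fps_exp 1 oo (F + G) = (fps_exp 1 oo F) * (fps_exp 1 oo G)"
  by (rule fps_linear_ode_unique[where G = "fps_deriv (F + G)"])
     (simp_all add: fps_compose_deriv assms algebra_simps)

lemma exp_compose_sum:
  fixes F :: "nat \<Rightarrow> rat fps"
  assumes "\<And>i. fps_nth (F i) 0 = 0"
  shows "fps_exp 1 oo (\<Sum>i\<le>N. F i) = (\<Prod>i\<le>N. fps_exp 1 oo F i)"
  by (induction N) (simp_all add: exp_compose_add assms fps_sum_nth)

lemma binomial_eq_exp: "fps_binomial c = fps_exp 1 oo (fps_const c * fps_ln (1::rat))"
  by (rule fps_linear_ode_unique[where G = "fps_const c * inverse (1 + fps_X)"])
     (simp_all add: fps_binomial_deriv fps_compose_deriv fps_ln_deriv fps_divide_unit mult_ac)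

definition log_factor :: "nat \<Rightarrow> rat fps" where
  "log_factor i = Abs_fps (\<lambda>m. if m > 0 \<and> i dvd m then 1 / of_nat m else 0)"

lemma fps_compose_neg_X_power_nth:
  fixes f :: "rat fps"
  assumes "i > 0"
  shows "fps_nth (f oo - (fps_X ^ i)) m =
    (if i dvd m then (-1) ^ (m div i) * fps_nth f (m div i) else 0)"
proof -
  have nth: "fps_nth ((- (fps_X ^ i) :: rat fps) ^ j) m = (if m = i * j then (-1) ^ j else 0)" for j
  proof -
    have "(- (fps_X ^ i) :: rat fps) ^ j = fps_const ((-1) ^ j) * fps_X ^ (i * j)"
      by (subst power_minus) (simp add: power_mult flip: fps_const_power fps_const_neg)
    thus ?thesis by (simp only: fps_mult_left_const_nth fps_X_power_nth) simp
  qed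
  have "fps_nth (f oo - (fps_X ^ i)) m =
      (\<Sum>j = 0..m. if m = i * j then (-1) ^ j * fps_nth f j else 0)"
    unfolding fps_compose_nth by (intro sum.cong refl) (simp add: nth)
  also have "\<dots> = (if i dvd m then (-1) ^ (m div i) * fps_nth f (m div i) else 0)"
  proof (cases "i dvd m")
    case True
    then obtain k where k: "m = i * k" by auto
    have "k \<le> m" "\<And>j. m = i * j \<longleftrightarrow> j = k" "m div i = k" using k assms by auto
    with True show ?thesis by simp
  next
    case False
    hence "\<And>j. m \<noteq> i * j" by auto
    with False show ?thesis by simp
  qed
  finally show ?thesis .
qed

lemma binomial_factor:
  assumes "i > 0"
  shows "fps_binomial (- 1 / of_nat i) oo - (fps_X ^ i) = fps_exp 1 oo log_factor i"
proof -
  have "(fps_const (- 1 / of_nat i) * fps_ln 1) oo - (fps_X ^ i) = log_factor i"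
  proof (rule fps_ext)
    fix m
    show "fps_nth ((fps_const (- 1 / of_nat i) * fps_ln 1) oo - (fps_X ^ i)) m =
        fps_nth (log_factor i) m"
    proof (cases "i dvd m \<and> m > 0")
      case True
      then obtain k where k: "m = i * k" "k > 0" by auto
      have "(-1) ^ k * (-1) ^ (k - 1) = (-1 :: rat)"
        using k by (cases k) (simp_all flip: power_mult_distrib)
      thus ?thesis using assms k
        by (simp add: fps_compose_neg_X_power_nth log_factor_def fps_ln_nth field_simps)
    next
      case False
      thus ?thesis using assms
        by (auto simp: fps_compose_neg_X_power_nth log_factor_def fps_ln_nth)
    qed
  qed
  thus ?thesis
    using assms by (simp add: binomial_eq_exp fps_compose_assoc[symmetric])
qed

lemma sum_log_factor_nth:
  assumes "m \<le> N"
  shows "fps_nth (\<Sum>i\<le>N. log_factor (Suc i)) m = fps_nth divisor_series m"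
proof (cases "m = 0")
  case False
  have "fps_nth (\<Sum>i\<le>N. log_factor (Suc i)) m =
      (\<Sum>i\<le>N. if Suc i dvd m then 1 / of_nat m else 0)"
    using False by (simp add: fps_sum_nth log_factor_def)
  also have "\<dots> = of_nat (card {i\<in>{..N}. Suc i dvd m}) / of_nat m"
    by (subst sum.inter_filter[symmetric]) simp_all
  also have "card {i\<in>{..N}. Suc i dvd m} = card (Suc ` {i\<in>{..N}. Suc i dvd m})"
    by (simp add: card_image)
  also have "Suc ` {i\<in>{..N}. Suc i dvd m} = {d. d dvd m}"
  proof (intro equalityI subsetI)
    fix d assume d: "d \<in> {d. d dvd m}"
    then obtain i where i: "d = Suc i" using False by (cases d) auto
    have "d \<le> m" using d False by (simp add: dvd_imp_le)
    thus "d \<in> Suc ` {i\<in>{..N}. Suc i dvd m}" using d i assms by auto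
  qed auto
  finally show ?thesis using False by (simp add: divisor_series_def num_divisors_def)
qed (simp add: fps_sum_nth log_factor_def)

lemma exp_compose_nth_cong:
  fixes F G :: "rat fps"
  assumes "\<And>m. m \<le> n \<Longrightarrow> fps_nth F m = fps_nth G m"
  shows "fps_nth (H oo F) n = fps_nth (H oo G) n"
proof -
  have "fps_nth (F ^ j) m = fps_nth (G ^ j) m" if "m \<le> n" for j m
    using that by (induction j arbitrary: m) (auto simp: fps_mult_nth assms intro!: sum.cong)
  thus ?thesis by (simp add: fps_compose_nth)
qed

lemma a_egf_product:
  "(\<lambda>i. fps_binomial (- 1 / of_nat (Suc i)) oo - (fps_X ^ Suc i)) has_prod a_egf"
  (is "?f has_prod _")
proof -
  have f: "?f i = fps_exp 1 oo log_factor (Suc i)" for i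
    by (rule binomial_factor) simp
  have prod: "(\<Prod>i\<le>N. ?f i) = fps_exp 1 oo (\<Sum>i\<le>N. log_factor (Suc i))" for N
    unfolding f by (rule exp_compose_sum[symmetric]) (simp add: log_factor_def)
  have "(\<lambda>N. \<Prod>i\<le>N. ?f i) \<longlonglongrightarrow> a_egf"
  proof (rule tendsto_fpsI)
    fix n
    show "eventually (\<lambda>N. fps_nth (\<Prod>i\<le>N. ?f i) n = fps_nth a_egf n) sequentially"
      using eventually_ge_at_top[of n]
    proof eventually_elim
      case (elim N)
      show ?case unfolding prod a_egf_def
        by (rule exp_compose_nth_cong) (use elim in \<open>auto intro!: sum_log_factor_nth\<close>)
    qed
  qed
  moreover have "a_egf \<noteq> 0"
    using a_egf_nth_0 by fastforce
  ultimately show ?thesis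
    by (simp add: has_prod_def raw_has_prod_def del: power_Suc of_nat_Suc)
qed

end

theory Submission
  imports Defs "HOL-Number_Theory.Residues"
begin

text \<open>Write \<open>F\<close> for the exponential generating function of \<open>a\<close>, \<open>S\<close> for the exponent, so that
  \<open>F = exp S\<close>, and \<open>D\<close> for differentiation. Since \<open>D^k\<close> shifts the sequence by \<open>k\<close>, the claim is
  about \<open>D^k F\<close> modulo \<open>k\<close>, where \<open>m\<close> divides a series if it divides every \<open>n!\<close> times the
  \<open>n\<close>-th coefficient. Series with integral such coefficients form a ring that is closed under \<open>D\<close>.

  What drives the proof is that \<open>G = D F / F = D S = \<Sum> d(m+1) x^m\<close> has integral \<^emph>\<open>ordinary\<close>
  coefficients, and hence so has \<open>P = D^k F / F\<close>. For an ordinary integral series \<open>f\<close>, the series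
  \<open>D^i f\<close> is divisible by \<open>i!\<close>, and \<open>k\<close> divides \<open>(k choose i) * i!\<close> for \<open>i > 0\<close>. So the Leibniz rule
  collapses to \<open>D^k (f g) \<equiv> f * D^k g\<close> modulo \<open>k\<close>. With \<open>f = G\<close> and \<open>g = F\<close> it shows that \<open>D^k F\<close>
  solves the differential equation of \<open>F\<close> modulo \<open>k\<close>, and so \<open>D^k F \<equiv> a(k) F\<close>, that is,
  \<open>a(n + k) \<equiv> a(k) a(n)\<close> modulo \<open>k\<close>, for every \<open>k\<close> (\<open>nth_deriv_cong\<close>, \<open>a_shift_cong\<close>).

  By composing shifts it remains to treat prime powers \<open>k\<close>. For an odd prime \<open>p\<close>, the expansion of
  \<open>exp S\<close> and Wilson's theorem give \<open>a(p) \<equiv> -1\<close> modulo \<open>p\<close> (\<open>a_prime_cong\<close>); for the prime 2, one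
  computes \<open>a(2)\<close> and \<open>a(8)\<close>. The step from \<open>k = p^e\<close> to \<open>p k\<close> is \<open>nth_deriv_cong_lift\<close>: if
  \<open>D^k F \<equiv> \<epsilon> F\<close> modulo \<open>k\<close> with \<open>\<epsilon>\<close> a sign, then iterating \<open>D^k\<close> gives
  \<open>D^(j k) F \<equiv> (P^j + (j choose 2) \<epsilon>^j D^k P) F\<close> modulo \<open>p k\<close>. At \<open>j = p\<close> the first term is \<open>\<epsilon>^p\<close>
  because \<open>P \<equiv> \<epsilon>\<close> modulo \<open>k\<close>. The second one vanishes if \<open>p\<close> is odd, because \<open>p\<close> divides
  \<open>p choose 2\<close> and \<open>k\<close> divides \<open>D^k P\<close>, and also if \<open>p = 2\<close> and \<open>k \<ge> 4\<close>, because \<open>2 k\<close> divides \<open>k!\<close>.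
  The exception for \<open>k \<equiv> 4\<close> modulo 8 is the failure of \<open>a(n + 4) \<equiv> a(n)\<close> modulo 4 (indeed
  \<open>a(4) = 59\<close>), where only the congruence modulo 2 is left.\<close>

section \<open>Divisibility of exponential generating functions\<close>

definition egf_dvd :: "int \<Rightarrow> rat fps \<Rightarrow> bool" where
  "egf_dvd m f \<longleftrightarrow> (\<forall>n. \<exists>z. fact n * fps_nth f n = of_int (m * z))"

lemma egf_dvdE:
  assumes "egf_dvd m f"
  obtains z where "\<And>n. fact n * fps_nth f n = of_int (m * z n)"
  using assms unfolding egf_dvd_def by metis

lemma egf_dvdI: "(\<And>n. fact n * fps_nth f n = of_int (m * z n)) \<Longrightarrow> egf_dvd m f"
  unfolding egf_dvd_def by blast

lemma egf_dvd_add: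
  assumes "egf_dvd m f" "egf_dvd m g"
  shows "egf_dvd m (f + g)"
proof -
  obtain u where "\<And>n. fact n * fps_nth f n = of_int (m * u n)"
    using assms(1) by (rule egf_dvdE) blast
  moreover obtain v where "\<And>n. fact n * fps_nth g n = of_int (m * v n)"
    using assms(2) by (rule egf_dvdE) blast
  ultimately show ?thesis
    by (intro egf_dvdI[of _ _ "\<lambda>n. u n + v n"]) (simp add: distrib_left)
qed

lemma egf_dvd_0 [simp]: "egf_dvd m 0"
  by (rule egf_dvdI[of _ _ "\<lambda>_. 0"]) simp

lemma egf_dvd_of_int:
  assumes "m dvd c"
  shows "egf_dvd m (of_int c)"
proof -
  from assms obtain d where "c = m * d" by blast
  thus ?thesis by (intro egf_dvdI[of _ _ "\<lambda>n. if n = 0 then d else 0"]) simp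
qed

lemma egf_dvd_1 [simp]: "egf_dvd 1 1"
  using egf_dvd_of_int[of 1 1] by simp

lemma egf_dvd_mult:
  assumes "egf_dvd m f" "egf_dvd l g"
  shows "egf_dvd (m * l) (f * g)"
proof -
  obtain u where u: "\<And>n. fact n * fps_nth f n = of_int (m * u n)"
    using assms(1) by (rule egf_dvdE) blast
  obtain v where v: "\<And>n. fact n * fps_nth g n = of_int (l * v n)"
    using assms(2) by (rule egf_dvdE) blast
  have "fact n * fps_nth (f * g) n =
      of_int (m * l * (\<Sum>i=0..n. int (n choose i) * u i * v (n - i)))" for n
  proof -
    have "fact n * fps_nth (f * g) n = (\<Sum>i=0..n. fact n * (fps_nth f i * fps_nth g (n - i)))"
      by (simp add: fps_mult_nth sum_distrib_left)
    also have "\<dots> = (\<Sum>i=0..n. of_nat (n choose i) * of_int (m * u i) * of_int (l * v (n - i)))"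
    proof (intro sum.cong refl)
      fix i assume "i \<in> {0..n}"
      hence "(fact n :: rat) = of_nat (n choose i) * fact i * fact (n - i)"
        by (simp add: binomial_fact)
      thus "fact n * (fps_nth f i * fps_nth g (n - i)) =
          of_nat (n choose i) * of_int (m * u i) * of_int (l * v (n - i))"
        unfolding u[symmetric] v[symmetric] by simp
    qed
    also have "\<dots> = of_int (m * l * (\<Sum>i=0..n. int (n choose i) * u i * v (n - i)))"
      by (simp add: sum_distrib_left mult_ac)
    finally show ?thesis .
  qed
  thus ?thesis by (rule egf_dvdI)
qed

lemma egf_dvd_mult_left: "egf_dvd 1 f \<Longrightarrow> egf_dvd m g \<Longrightarrow> egf_dvd m (f * g)"
  using egf_dvd_mult[of 1 f m g] by simp

lemma egf_dvd_mult_right: "egf_dvd m f \<Longrightarrow> egf_dvd 1 g \<Longrightarrow> egf_dvd m (f * g)"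
  using egf_dvd_mult[of m f 1 g] by simp

lemma egf_dvd_trans:
  assumes "l dvd m" "egf_dvd m f"
  shows "egf_dvd l f"
proof -
  from assms(1) obtain c where "m = l * c" by blast
  moreover obtain z where "\<And>n. fact n * fps_nth f n = of_int (m * z n)"
    using assms(2) by (rule egf_dvdE) blast
  ultimately show ?thesis by (intro egf_dvdI[of _ _ "\<lambda>n. c * z n"]) (simp add: mult.assoc)
qed

lemma egf_dvd_sum: "(\<And>i. i \<in> A \<Longrightarrow> egf_dvd m (f i)) \<Longrightarrow> egf_dvd m (sum f A)"
  by (induction A rule: infinite_finite_induct) (auto intro: egf_dvd_add)

lemma egf_dvd_power: "egf_dvd 1 f \<Longrightarrow> egf_dvd 1 (f ^ n)"
  by (induction n) (auto intro: egf_dvd_mult_left)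

lemma egf_dvd_deriv: "egf_dvd m f \<Longrightarrow> egf_dvd m (fps_deriv f)"
  unfolding egf_dvd_def
proof
  fix n assume "\<forall>n. \<exists>z. fact n * fps_nth f n = of_int (m * z)"
  then obtain z where "fact (Suc n) * fps_nth f (Suc n) = of_int (m * z)" by blast
  thus "\<exists>z. fact n * fps_nth (fps_deriv f) n = of_int (m * z)"
    by (intro exI[of _ z]) (simp add: algebra_simps)
qed

lemma egf_dvd_nth_deriv: "egf_dvd m f \<Longrightarrow> egf_dvd m (fps_nth_deriv k f)"
  by (induction k arbitrary: f) (simp_all add: egf_dvd_deriv)

lemma egf_dvd_of_deriv:
  assumes "egf_dvd m (fps_deriv f)" "fps_nth f 0 = of_int c" "m dvd c"
  shows "egf_dvd m f"
  unfolding egf_dvd_def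
proof
  fix n
  show "\<exists>z. fact n * fps_nth f n = of_int (m * z)"
  proof (cases n)
    case 0
    with assms(2,3) show ?thesis by (auto elim!: dvdE)
  next
    case (Suc j)
    from assms(1) obtain z where "fact j * fps_nth (fps_deriv f) j = of_int (m * z)"
      unfolding egf_dvd_def by blast
    thus ?thesis unfolding Suc by (intro exI[of _ z]) (simp add: algebra_simps)
  qed
qed

text \<open>Comparing the coefficients of order \<open>n\<close>, those of \<open>g\<close> of lower order are divisible by
  \<open>m\<close> by induction, and that of order \<open>n\<close> is multiplied by the constant term 1 of \<open>f\<close>.\<close>

lemma egf_dvd_cancel:
  assumes f: "egf_dvd 1 f" "fps_nth f 0 = 1" and fg: "egf_dvd m (f * g)"
  shows "egf_dvd m g"
  unfolding egf_dvd_def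
proof
  fix n
  show "\<exists>z. fact n * fps_nth g n = of_int (m * z)"
  proof (induction n rule: less_induct)
    case (less n)
    then obtain v where v: "\<And>j. j < n \<Longrightarrow> fact j * fps_nth g j = of_int (m * v j)"
      by metis
    obtain u where u: "\<And>j. fact j * fps_nth f j = of_int (1 * u j)"
      using f(1) by (rule egf_dvdE) blast
    obtain w where w: "fact n * fps_nth (f * g) n = of_int (m * w)"
      using fg unfolding egf_dvd_def by blast
    have "of_int (m * w) = (\<Sum>i=0..n. fact n * (fps_nth f i * fps_nth g (n - i)))"
      by (simp only: w[symmetric] fps_mult_nth sum_distrib_left)
    also have "\<dots> = fact n * fps_nth g n + (\<Sum>i=1..n. fact n * (fps_nth f i * fps_nth g (n - i)))"
      by (simp add: sum.atLeast_Suc_atMost f)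
    also have "(\<Sum>i=1..n. fact n * (fps_nth f i * fps_nth g (n - i))) =
        (\<Sum>i=1..n. of_nat (n choose i) * of_int (1 * u i) * of_int (m * v (n - i)))"
    proof (intro sum.cong refl)
      fix i assume i: "i \<in> {1..n}"
      hence "(fact n :: rat) = of_nat (n choose i) * fact i * fact (n - i)"
        by (simp add: binomial_fact)
      moreover have "fact (n - i) * fps_nth g (n - i) = of_int (m * v (n - i))"
        using i by (intro v) auto
      ultimately show "fact n * (fps_nth f i * fps_nth g (n - i)) =
          of_nat (n choose i) * of_int (1 * u i) * of_int (m * v (n - i))"
        unfolding u[symmetric] by (simp add: mult_ac)
    qed
    also have "\<dots> = of_int (m * (\<Sum>i=1..n. int (n choose i) * u i * v (n - i)))"
      by (simp add: sum_distrib_left mult_ac)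
    finally have "fact n * fps_nth g n =
        of_int (m * (w - (\<Sum>i=1..n. int (n choose i) * u i * v (n - i))))"
      by (simp add: algebra_simps)
    thus ?case by blast
  qed
qed

lemma fact_mult_nth_deriv:
  "fact n * fps_nth (fps_nth_deriv k f) n = (fact (n + k) * fps_nth f (n + k) :: rat)"
proof (induction k arbitrary: f)
  case (Suc k)
  show ?case by (simp add: Suc algebra_simps)
qed simp

text \<open>The \<open>n\<close>-th coefficient of the derivative, times \<open>n!\<close>, is \<open>(n + k)!\<close> times a coefficient of \<open>f\<close>.
  This is the gain of ordinary integrality over integrality of \<open>n!\<close> times the coefficients.\<close>

lemma fact_dvd_nth_deriv:
  assumes "\<And>n. fps_nth f n \<in> \<int>"
  shows "egf_dvd (fact k) (fps_nth_deriv k f)"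
  unfolding egf_dvd_def
proof
  fix n
  from assms obtain z where z: "fps_nth f (n + k) = of_int z" by (meson Ints_cases)
  obtain w :: int where w: "fact (n + k) = fact k * w"
    using fact_dvd[of k "n + k"] by (metis dvdE le_add2)
  have "fact (n + k) = (of_int (fact k * w) :: rat)"
    by (simp only: flip: w) simp
  thus "\<exists>z. fact n * fps_nth (fps_nth_deriv k f) n = of_int (fact k * z)"
    unfolding fact_mult_nth_deriv z by (intro exI[of _ "w * z"]) simp
qed

lemma fps_mult_integral:
  fixes f g :: "rat fps"
  assumes "\<And>n. fps_nth f n \<in> \<int>" "\<And>n. fps_nth g n \<in> \<int>"
  shows "fps_nth (f * g) n \<in> \<int>"
  unfolding fps_mult_nth by (intro Ints_sum Ints_mult assms)

section \<open>The Leibniz rule modulo an integer\<close>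

lemma fps_nth_deriv_mult:
  fixes f g :: "'a :: comm_ring_1 fps"
  shows "fps_nth_deriv n (f * g) =
    (\<Sum>i\<le>n. of_nat (n choose i) * (fps_nth_deriv i f * fps_nth_deriv (n - i) g))"
proof (induction n arbitrary: f g)
  case (Suc n)
  let ?t = "\<lambda>i. fps_nth_deriv i f * fps_nth_deriv (Suc n - i) g"
  have "fps_nth_deriv (Suc n) (f * g) =
      fps_nth_deriv n (fps_deriv f * g) + fps_nth_deriv n (f * fps_deriv g)"
    by (simp add: add.commute)
  also have "fps_nth_deriv n (f * fps_deriv g) = (\<Sum>i\<le>n. of_nat (n choose i) * ?t i)"
    unfolding Suc by (intro sum.cong refl) (simp add: Suc_diff_le)
  also have "\<dots> = (\<Sum>i\<le>Suc n. of_nat (n choose i) * ?t i)"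
    by (simp add: binomial_eq_0)
  also have "\<dots> = ?t 0 + (\<Sum>i\<le>n. of_nat (n choose Suc i) * ?t (Suc i))"
    by (subst sum.atMost_Suc_shift) simp
  also have "fps_nth_deriv n (fps_deriv f * g) = (\<Sum>i\<le>n. of_nat (n choose i) * ?t (Suc i))"
    unfolding Suc by simp
  also have "(\<Sum>i\<le>n. of_nat (n choose i) * ?t (Suc i)) +
      (?t 0 + (\<Sum>i\<le>n. of_nat (n choose Suc i) * ?t (Suc i))) =
      ?t 0 + (\<Sum>i\<le>n. of_nat (Suc n choose Suc i) * ?t (Suc i))"
    by (simp add: distrib_right sum.distrib)
  also have "\<dots> = (\<Sum>i\<le>Suc n. of_nat (Suc n choose i) * ?t i)"
    by (subst sum.atMost_Suc_shift) simp
  finally show ?case .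
qed simp

text \<open>By absorption \<open>p^e\<close> divides \<open>i * (p^e choose i)\<close>, but \<open>i\<close> is too small to be a multiple of \<open>p^e\<close>.\<close>

lemma prime_dvd_choose_prime_power:
  fixes p :: nat
  assumes "prime p" "0 < i" "i < p ^ e"
  shows "p dvd (p ^ e choose i)"
proof (rule ccontr)
  assume "\<not> p dvd (p ^ e choose i)"
  hence "coprime (p ^ e) (p ^ e choose i)"
    using assms(1) by (simp add: prime_imp_coprime)
  moreover have "p ^ e dvd i * (p ^ e choose i)"
    using times_binomial_minus1_eq[OF assms(2), of "p ^ e"] by simp
  ultimately have "p ^ e dvd i" by (simp add: coprime_dvd_mult_left_iff)
  with assms(2,3) show False by (auto dest: dvd_imp_le)
qed

lemma dvd_choose_mult_fact:
  assumes "0 < i"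
  shows "k dvd (k choose i) * fact i"
proof -
  obtain j where j: "i = Suc j" using assms by (cases i) auto
  have "(k choose i) * fact i = (i * (k choose i)) * fact j"
    unfolding j by (simp add: algebra_simps del: binomial_Suc_Suc)
  also have "\<dots> = k * ((k - 1) choose j) * fact j"
    using times_binomial_minus1_eq[OF assms, of k] by (simp add: j)
  finally show ?thesis by simp
qed

lemma nth_deriv_of_int_mult:
  fixes f :: "'a :: comm_ring_1 fps"
  shows "fps_nth_deriv k (of_int c * f) = of_int c * fps_nth_deriv k f"
  by (simp flip: fps_of_int)

lemma nth_deriv_of_int: "k > 0 \<Longrightarrow> fps_nth_deriv k (of_int c :: 'a :: comm_ring_1 fps) = 0"
  by (simp flip: fps_of_int)

lemma nth_deriv_add_index:
  "fps_nth_deriv (k + l) f = fps_nth_deriv k (fps_nth_deriv l f)"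
  by (induction l arbitrary: f) simp_all

text \<open>In the Leibniz rule, the term of index \<open>i > 0\<close> is divisible by \<open>(k choose i) * i!\<close>, the
  factor \<open>i!\<close> coming from \<open>D^i f\<close>; this product is a multiple of \<open>k\<close>.\<close>

lemma nth_deriv_integral_mult_cong:
  fixes f g :: "rat fps"
  assumes f: "\<And>n. fps_nth f n \<in> \<int>" and g: "egf_dvd 1 g"
  shows "egf_dvd (int k) (fps_nth_deriv k (f * g) - f * fps_nth_deriv k g)"
proof -
  have "fps_nth_deriv k (f * g) - f * fps_nth_deriv k g =
      (\<Sum>i\<in>{1..k}. of_nat (k choose i) * (fps_nth_deriv i f * fps_nth_deriv (k - i) g))"
    by (simp add: fps_nth_deriv_mult atMost_atLeast0 sum.atLeast_Suc_atMost)
  also have "egf_dvd (int k) \<dots>"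
  proof (rule egf_dvd_sum)
    fix i assume i: "i \<in> {1..k}"
    have "egf_dvd (int (k choose i) * fact i * 1)
        (of_int (int (k choose i)) * fps_nth_deriv i f * fps_nth_deriv (k - i) g)"
      by (intro egf_dvd_mult egf_dvd_of_int fact_dvd_nth_deriv egf_dvd_nth_deriv f g) simp
    moreover have "int k dvd int (k choose i) * fact i * 1"
      using dvd_choose_mult_fact[of i k] i
      by (metis One_nat_def Suc_le_eq atLeastAtMost_iff int_dvd_int_iff mult.right_neutral
          of_nat_fact of_nat_mult)
    ultimately show "egf_dvd (int k)
        (of_nat (k choose i) * (fps_nth_deriv i f * fps_nth_deriv (k - i) g))"
      using egf_dvd_trans by (simp add: mult.assoc)
  qed
  finally show ?thesis .
qed

text \<open>Modulo a prime, \<open>D^(p^e)\<close> is a derivation. If moreover \<open>f\<close> is constant modulo \<open>m\<close>, then its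
  derivatives contribute a factor \<open>m\<close> in addition to the factor \<open>p\<close> of the binomial coefficient.
  The lifting step uses this with \<open>m = p^e\<close>; for \<open>m = 1\<close> the hypothesis on \<open>f\<close> is integrality only.\<close>

lemma nth_deriv_mult_cong_prime_power:
  fixes f g :: "rat fps" and p e :: nat
  defines "k \<equiv> p ^ e"
  assumes p: "prime p" and f: "egf_dvd m (f - of_int c)" and g: "egf_dvd 1 g"
  shows "egf_dvd (int p * m)
    (fps_nth_deriv k (f * g) - (f * fps_nth_deriv k g + fps_nth_deriv k f * g))"
proof -
  have "k > 0" using p by (simp add: k_def prime_gt_0_nat)
  have "{..k} = insert 0 (insert k {0<..<k})" using \<open>k > 0\<close> by auto
  hence "fps_nth_deriv k (f * g) - (f * fps_nth_deriv k g + fps_nth_deriv k f * g) =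
      (\<Sum>i\<in>{0<..<k}. of_nat (k choose i) * (fps_nth_deriv i f * fps_nth_deriv (k - i) g))"
    using \<open>k > 0\<close> by (simp add: fps_nth_deriv_mult)
  also have "egf_dvd (int p * m) \<dots>"
  proof (rule egf_dvd_sum)
    fix i assume i: "i \<in> {0<..<k}"
    have "egf_dvd m (fps_nth_deriv i (f - of_int c))"
      by (intro egf_dvd_nth_deriv f)
    hence f_i: "egf_dvd m (fps_nth_deriv i f)"
      using i by (simp add: nth_deriv_of_int)
    have "egf_dvd (int p * m * 1)
        (of_int (int (k choose i)) * fps_nth_deriv i f * fps_nth_deriv (k - i) g)"
      using prime_dvd_choose_prime_power[OF p, of i e] i
      by (intro egf_dvd_mult egf_dvd_of_int f_i egf_dvd_nth_deriv[OF g]) (auto simp: k_def)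
    thus "egf_dvd (int p * m)
        (of_nat (k choose i) * (fps_nth_deriv i f * fps_nth_deriv (k - i) g))"
      by (simp add: mult.assoc)
  qed
  finally show ?thesis .
qed

section \<open>Series with an integral logarithmic derivative\<close>

text \<open>The asymmetry is deliberate: \<open>G\<close> is integral as an ordinary generating function, which makes
  its higher derivatives divisible by factorials, but \<open>F\<close> only as an exponential one.\<close>

locale integral_log_deriv =
  fixes F G :: "rat fps"
  assumes deriv_F: "fps_deriv F = G * F"
    and G_integral: "\<And>n. fps_nth G n \<in> \<int>"
    and F_0: "fps_nth F 0 = 1"
    and F_integral: "egf_dvd 1 F"
begin

lemma nth_deriv_quotient:
  obtains P where "\<And>n. fps_nth P n \<in> \<int>" "fps_nth_deriv k F = P * F"
proof -
  have "\<exists>P. (\<forall>n. fps_nth P n \<in> \<int>) \<and> fps_nth_deriv k F = P * F"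
  proof (induction k)
    case 0
    show ?case by (intro exI[of _ 1]) simp
  next
    case (Suc k)
    then obtain P where P: "\<And>n. fps_nth P n \<in> \<int>" "fps_nth_deriv k F = P * F" by blast
    have "fps_nth_deriv (Suc k) F = (fps_deriv P + P * G) * F"
      unfolding fps_nth_deriv_commute P(2) by (simp add: deriv_F algebra_simps)
    moreover have "fps_nth (fps_deriv P + P * G) n \<in> \<int>" for n
      using P(1) fps_mult_integral[OF P(1) G_integral] by (auto intro!: Ints_add Ints_mult simp del: of_nat_Suc)
    ultimately show ?case by blast
  qed
  thus ?thesis using that by blast
qed

lemma quotient_integral: "fps_nth_deriv k F = P * F \<Longrightarrow> egf_dvd 1 P"
  using egf_dvd_cancel[OF F_integral F_0, of 1 P] egf_dvd_nth_deriv[OF F_integral, of k]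
  by (simp add: mult.commute)

text \<open>Both \<open>F\<close> and, modulo \<open>k\<close>, also \<open>D^k F\<close> solve the equation \<open>D X = G * X\<close>: here
  \<open>D (D^k F) = D^k (G * F) \<equiv> G * D^k F\<close>. Hence their quotient has derivative 0 modulo \<open>k\<close> and is
  congruent to its constant term, which is \<open>c\<close>.\<close>

lemma nth_deriv_cong:
  assumes "fact k * fps_nth F k = of_int c"
  shows "egf_dvd (int k) (fps_nth_deriv k F - of_int c * F)"
proof -
  obtain P where P: "fps_nth_deriv k F = P * F" by (rule nth_deriv_quotient) blast
  have P_int: "egf_dvd 1 P" by (rule quotient_integral[OF P])
  have "fps_nth_deriv (Suc k) F = fps_deriv P * F + P * (G * F)"
    unfolding fps_nth_deriv_commute P by (simp add: deriv_F algebra_simps)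
  hence "F * fps_deriv P = fps_nth_deriv k (G * F) - G * fps_nth_deriv k F"
    by (simp add: deriv_F P algebra_simps)
  hence "egf_dvd (int k) (F * fps_deriv P)"
    using nth_deriv_integral_mult_cong[OF G_integral F_integral] by simp
  hence "egf_dvd (int k) (fps_deriv (P - of_int c))"
    using egf_dvd_cancel[OF F_integral F_0] by simp
  moreover have "fps_nth (P - of_int c) 0 = of_int 0"
  proof -
    have "fps_nth (P * F) 0 = of_int c"
      unfolding P[symmetric] using fact_mult_nth_deriv[of 0 k F] assms by simp
    thus ?thesis by (simp add: F_0)
  qed
  ultimately have "egf_dvd (int k) (P - of_int c)" by (rule egf_dvd_of_deriv) simp
  thus ?thesis unfolding P left_diff_distrib[symmetric]
    by (rule egf_dvd_mult_right[OF _ F_integral])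
qed

text \<open>Put \<open>D^k F = P * F\<close> and \<open>V = D^k P\<close>. As \<open>P \<equiv> \<epsilon>\<close> modulo \<open>k\<close>, the operator \<open>D^k\<close> acts modulo
  \<open>p * k\<close> as a derivation on products with a polynomial in \<open>P\<close> and \<open>V\<close>. Applying it to \<open>P^j * F\<close>
  gives \<open>P^(j+1) * F\<close> and a correction \<open>j \<epsilon>^(j-1) V * F\<close>; the corrections add up to a binomial
  coefficient \<open>j choose 2\<close>. They are not corrected themselves any more, because \<open>D^k V = D^(2k) P\<close>
  is divisible by \<open>(2 k)!\<close> and so by \<open>p * k\<close>.\<close>

lemma nth_deriv_cong_lift:
  fixes p e :: nat and \<epsilon> :: int
  defines "k \<equiv> p ^ e"
  assumes p: "prime p" and e: "e > 0" and k: "odd p \<or> 4 \<le> k" and \<epsilon>: "\<epsilon> * \<epsilon> = 1"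
    and cong: "egf_dvd (int k) (fps_nth_deriv k F - of_int \<epsilon> * F)"
  shows "egf_dvd (int (p * k)) (fps_nth_deriv (p * k) F - of_int (\<epsilon> ^ p) * F)"
proof -
  let ?D = "fps_nth_deriv k" and ?M = "int (p * k)"
  have "k > 0" using p by (simp add: k_def prime_gt_0_nat)
  have p_dvd_k: "p dvd k" using e by (simp add: k_def)
  hence M_dvd_kk: "?M dvd int k * int k" by (simp add: mult_dvd_mono)
  obtain P where P_coeffs: "\<And>n. fps_nth P n \<in> \<int>" and P: "?D F = P * F"
    by (rule nth_deriv_quotient) blast
  define V where "V = ?D P"
  \<comment> \<open>Since \<open>\<eta> * \<eta> = 1\<close>, a power \<open>\<eta> ^ (j - 1)\<close> can be written as \<open>\<eta> ^ Suc j\<close>, which is meaningful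
    for \<open>j = 0\<close> as well.\<close>
  define \<eta> :: "rat fps" where "\<eta> = of_int \<epsilon>"
  have eta2: "\<eta> * \<eta> = 1" unfolding \<eta>_def by (metis \<epsilon> of_int_1 of_int_mult)
  have eta2': "\<eta> * (\<eta> * x) = x" for x by (simp add: eta2 flip: mult.assoc)
  have eta_int: "egf_dvd 1 \<eta>" unfolding \<eta>_def by (rule egf_dvd_of_int) simp
  have P_int: "egf_dvd 1 P" by (rule quotient_integral[OF P])
  have P_cong: "egf_dvd (int k) (P - \<eta>)"
    using cong egf_dvd_cancel[OF F_integral F_0, of "int k" "P - \<eta>"]
    by (simp add: P \<eta>_def algebra_simps)
  have V_dvd: "egf_dvd (fact k) V"
    unfolding V_def by (rule fact_dvd_nth_deriv[OF P_coeffs])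
  have V_k: "egf_dvd (int k) V"
  proof (rule egf_dvd_trans[OF _ V_dvd])
    have "k dvd fact k" using \<open>k > 0\<close> by (simp add: dvd_fact)
    thus "int k dvd fact k" by (metis int_dvd_int_iff of_nat_fact)
  qed
  have V_int: "egf_dvd 1 V" by (rule egf_dvd_trans[OF _ V_k]) simp
  have DV: "egf_dvd ?M (?D V)"
  proof -
    have "p * k dvd fact k * fact k"
      using p_dvd_k \<open>k > 0\<close> by (intro mult_dvd_mono) (auto intro: dvd_trans simp: dvd_fact)
    hence "p * k dvd fact (k + k)"
      using fact_fact_dvd_fact[of k k] dvd_trans by blast
    hence "int (p * k) dvd fact (k + k)"
      by (metis int_dvd_int_iff of_nat_fact)
    moreover have "egf_dvd (fact (k + k)) (?D V)"
      unfolding V_def nth_deriv_add_index[symmetric] by (rule fact_dvd_nth_deriv[OF P_coeffs])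
    ultimately show ?thesis by (rule egf_dvd_trans)
  qed
  have kk: "egf_dvd ?M (f * g)" if "egf_dvd (int k) f" "egf_dvd (int k) g" for f g
    by (rule egf_dvd_trans[OF M_dvd_kk egf_dvd_mult[OF that]])
  note int_intros = egf_dvd_mult_left[of _ 1] egf_dvd_power eta_int P_int V_int F_integral
  have P_power: "egf_dvd (int k) (P ^ j - \<eta> ^ j)" for j
  proof (induction j)
    case (Suc j)
    have "P ^ Suc j - \<eta> ^ Suc j = (P - \<eta>) * P ^ j + \<eta> * (P ^ j - \<eta> ^ j)"
      by (simp add: algebra_simps)
    thus ?case
      by (auto intro!: egf_dvd_add egf_dvd_mult_right[OF P_cong] egf_dvd_mult_left[OF _ Suc]
          int_intros)
  qed simp
  have D_P_power: "egf_dvd ?M (?D (P ^ j) - of_nat j * \<eta> ^ Suc j * V)" for j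
  proof (induction j)
    case 0
    show ?case using \<open>k > 0\<close> by simp
  next
    case (Suc j)
    \<comment> \<open>The Leibniz rule gives \<open>P * ?D (P ^ j) + V * P ^ j\<close>; next to \<open>V\<close>, which is divisible by \<open>k\<close>,
      both \<open>P\<close> and \<open>P ^ j\<close> may be replaced by powers of \<open>\<eta>\<close>.\<close>
    have "?D (P ^ Suc j) - of_nat (Suc j) * \<eta> ^ Suc (Suc j) * V =
        (?D (P * P ^ j) - (P * ?D (P ^ j) + ?D P * P ^ j))
        + P * (?D (P ^ j) - of_nat j * \<eta> ^ Suc j * V)
        + (of_int (int j) * \<eta> ^ Suc j) * ((P - \<eta>) * V)
        + (P ^ j - \<eta> ^ j) * V"
      by (simp add: V_def algebra_simps eta2')
    moreover have "egf_dvd ?M (?D (P * P ^ j) - (P * ?D (P ^ j) + ?D P * P ^ j))"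
      unfolding k_def of_nat_mult
      by (rule nth_deriv_mult_cong_prime_power[OF p, where c = \<epsilon>])
        (use P_cong in \<open>auto simp: k_def \<eta>_def intro!: int_intros\<close>)
    moreover have "egf_dvd ?M (P * (?D (P ^ j) - of_nat j * \<eta> ^ Suc j * V))"
      by (rule egf_dvd_mult_left[OF P_int Suc])
    moreover have "egf_dvd ?M ((of_int (int j) * \<eta> ^ Suc j) * ((P - \<eta>) * V))"
      by (intro egf_dvd_mult_left[OF _ kk] P_cong V_k int_intros egf_dvd_of_int) simp
    moreover have "egf_dvd ?M ((P ^ j - \<eta> ^ j) * V)"
      by (intro kk P_power V_k)
    ultimately show ?case by (metis egf_dvd_add)
  qed
  let ?R = "\<lambda>j. P ^ j + of_int (int (j choose 2)) * \<eta> ^ j * V"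
  have iterate: "egf_dvd ?M (fps_nth_deriv (j * k) F - ?R j * F)" for j
  proof (induction j)
    case 0
    show ?case by (simp add: binomial_eq_0)
  next
    case (Suc j)
    have R_cong: "egf_dvd (int k) (?R j - \<eta> ^ j)"
    proof -
      have "?R j - \<eta> ^ j = (P ^ j - \<eta> ^ j) + (of_int (int (j choose 2)) * \<eta> ^ j) * V" by simp
      also have "egf_dvd (int k) \<dots>"
        by (intro egf_dvd_add P_power egf_dvd_mult_left[OF _ V_k] int_intros egf_dvd_of_int) simp
      finally show ?thesis .
    qed
    have choose: "(Suc j choose 2) = (j choose 2) + j"
      by (simp add: numeral_2_eq_2)
    have D_R: "?D (?R j) = ?D (P ^ j) + of_int (int (j choose 2)) * \<eta> ^ j * ?D V"
      using nth_deriv_of_int_mult[of k "int (j choose 2) * \<epsilon> ^ j" V] by (simp add: \<eta>_def)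
    \<comment> \<open>In turn: the induction hypothesis, the product rule, \<open>P \<equiv> \<eta>\<close> next to \<open>V\<close>, the derivative of
      \<open>P ^ j\<close>, and the vanishing of \<open>?D V\<close>.\<close>
    have "fps_nth_deriv (Suc j * k) F - ?R (Suc j) * F =
        ?D (fps_nth_deriv (j * k) F - ?R j * F)
        + (?D (?R j * F) - (?R j * ?D F + ?D (?R j) * F))
        + (of_int (int (j choose 2)) * \<eta> ^ j) * ((P - \<eta>) * V) * F
        + (?D (P ^ j) - of_nat j * \<eta> ^ Suc j * V) * F
        + (of_int (int (j choose 2)) * \<eta> ^ j) * ?D V * F"
      unfolding D_R choose fps_nth_deriv_sub P mult_Suc nth_deriv_add_index
      by (simp add: algebra_simps)
    moreover have "egf_dvd ?M (?D (fps_nth_deriv (j * k) F - ?R j * F))"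
      by (rule egf_dvd_nth_deriv[OF Suc])
    moreover have "egf_dvd ?M (?D (?R j * F) - (?R j * ?D F + ?D (?R j) * F))"
      unfolding k_def of_nat_mult
      by (rule nth_deriv_mult_cong_prime_power[OF p, where c = "\<epsilon> ^ j"])
        (use R_cong F_integral in \<open>simp_all add: k_def \<eta>_def\<close>)
    moreover have "egf_dvd ?M ((of_int (int (j choose 2)) * \<eta> ^ j) * ((P - \<eta>) * V) * F)"
      by (intro egf_dvd_mult_right[OF egf_dvd_mult_left[OF _ kk]] P_cong V_k int_intros
          egf_dvd_of_int) simp
    moreover have "egf_dvd ?M ((?D (P ^ j) - of_nat j * \<eta> ^ Suc j * V) * F)"
      by (rule egf_dvd_mult_right[OF D_P_power F_integral])
    moreover have "egf_dvd ?M ((of_int (int (j choose 2)) * \<eta> ^ j) * ?D V * F)"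
      by (intro egf_dvd_mult_right[OF egf_dvd_mult_left[OF _ DV]] int_intros egf_dvd_of_int) simp
    ultimately show ?case by (metis egf_dvd_add)
  qed
  have P_power_first_order: "egf_dvd ?M (P ^ j - \<eta> ^ j - of_nat j * \<eta> ^ Suc j * (P - \<eta>))" for j
  proof (induction j)
    case (Suc j)
    have "P ^ Suc j - \<eta> ^ Suc j - of_nat (Suc j) * \<eta> ^ Suc (Suc j) * (P - \<eta>) =
        P * (P ^ j - \<eta> ^ j - of_nat j * \<eta> ^ Suc j * (P - \<eta>))
        + of_int (int j) * \<eta> ^ Suc j * ((P - \<eta>) * (P - \<eta>))"
      by (simp add: algebra_simps eta2 eta2')
    also have "egf_dvd ?M \<dots>"
      by (intro egf_dvd_add egf_dvd_mult_left[OF P_int Suc] egf_dvd_mult_left[OF _ kk]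
          P_cong int_intros egf_dvd_of_int) simp
    finally show ?case .
  qed simp
  have "egf_dvd (int p * int k) (of_int (int p) * (\<eta> ^ Suc p * (P - \<eta>)))"
    by (intro egf_dvd_mult egf_dvd_of_int egf_dvd_mult_left P_cong int_intros) simp
  with P_power_first_order[of p] have P_power_p: "egf_dvd ?M (P ^ p - \<eta> ^ p)"
    using egf_dvd_add by (fastforce simp: mult.assoc)
  have V_term: "egf_dvd ?M (of_int (int (p choose 2)) * V)"
  proof (cases "p = 2")
    case True
    hence "4 \<le> k" using k by simp
    hence "2 dvd (fact (k - 1) :: nat)" by (simp add: dvd_fact)
    hence "2 * k dvd fact (k - 1) * k" by simp
    also have "fact (k - 1) * k = fact k" using \<open>k > 0\<close> by (simp add: fact_num_eq_if)
    finally have "int (p * k) dvd fact k"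
      unfolding True by (metis int_dvd_int_iff of_nat_fact)
    hence "egf_dvd ?M V" using V_dvd by (rule egf_dvd_trans)
    thus ?thesis by (intro egf_dvd_mult_left egf_dvd_of_int) auto
  next
    case False
    hence "2 < p" using prime_ge_2_nat[OF p] by simp
    hence "p dvd (p choose 2)" using p by (intro dvd_choose_prime) auto
    hence "egf_dvd (int p * int k) (of_int (int (p choose 2)) * V)"
      by (intro egf_dvd_mult egf_dvd_of_int V_k) simp
    thus ?thesis by simp
  qed
  have "fps_nth_deriv (p * k) F - of_int (\<epsilon> ^ p) * F =
      (fps_nth_deriv (p * k) F - ?R p * F) + (P ^ p - \<eta> ^ p) * F
      + (of_int (int (p choose 2)) * V) * (\<eta> ^ p * F)"
    by (simp add: \<eta>_def algebra_simps)
  also have "egf_dvd ?M \<dots>"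
    by (intro egf_dvd_add iterate egf_dvd_mult_right[OF P_power_p F_integral]
        egf_dvd_mult_right[OF V_term] int_intros)
  finally show ?thesis .
qed

end

section \<open>The values at primes, and at 2 and 8\<close>

text \<open>The derivative of \<open>S^(i+1) / (i+1)!\<close> is \<open>S^i / i!\<close> times that of \<open>S\<close>, so integrality follows by
  integrating.\<close>

lemma divided_power_integral:
  assumes S: "egf_dvd 1 S" and S_0: "fps_nth S 0 = 0"
  shows "egf_dvd 1 (fps_const (1 / fact i) * S ^ i)"
proof (induction i)
  case (Suc i)
  have "fps_deriv (fps_const (1 / fact (Suc i)) * S ^ Suc i) =
      fps_const (1 / fact (Suc i) * of_nat (Suc i)) * (fps_deriv S * S ^ i)"
    by (simp only: fps_deriv_mult fps_deriv_power fps_deriv_const fps_const_mult[symmetric])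
      (simp add: mult_ac)
  also have "1 / fact (Suc i) * of_nat (Suc i) = (1 / fact i :: rat)"
    by (simp del: of_nat_Suc)
  finally have "fps_deriv (fps_const (1 / fact (Suc i)) * S ^ Suc i) =
      fps_deriv S * (fps_const (1 / fact i) * S ^ i)"
    by (simp add: mult_ac)
  hence "egf_dvd 1 (fps_deriv (fps_const (1 / fact (Suc i)) * S ^ Suc i))"
    using egf_dvd_mult_left[OF egf_dvd_deriv[OF S] Suc] by (simp only:)
  thus ?case by (rule egf_dvd_of_deriv[where c = 0]) (simp_all add: S_0)
qed simp

text \<open>Modulo \<open>p\<close> the operator \<open>D^p\<close> is a derivation. In \<open>S^i = S * S^(i-1)\<close> both factors have constant
  term 0, so the constant term of \<open>D^p (S^i)\<close> is divisible by \<open>p\<close>. Dividing by \<open>i!\<close>, which is prime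
  to \<open>p\<close>, leaves an integer and so preserves this.\<close>

lemma prime_dvd_divided_power_coeff:
  assumes p: "prime p" and i: "2 \<le> i" "i < p"
    and S: "egf_dvd 1 S" and S_0: "fps_nth S 0 = 0"
  obtains z where "fact p * fps_nth (S ^ i) p / fact i = of_int (int p * z)"
proof -
  obtain b where b: "fact p * fps_nth (fps_const (1 / fact i) * S ^ i) p = of_int (1 * b)"
    using divided_power_integral[OF S S_0, of i] unfolding egf_dvd_def by blast
  obtain j where j: "i = Suc j" "j > 0" using i by (cases i) auto
  have "egf_dvd (int p * 1) (fps_nth_deriv (p ^ 1) (S * S ^ j)
      - (S * fps_nth_deriv (p ^ 1) (S ^ j) + fps_nth_deriv (p ^ 1) S * S ^ j))"
    by (rule nth_deriv_mult_cong_prime_power[OF p, where c = 0])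
      (use S in \<open>auto intro: egf_dvd_power\<close>)
  then obtain w where "fact 0 * fps_nth (fps_nth_deriv (p ^ 1) (S * S ^ j)
      - (S * fps_nth_deriv (p ^ 1) (S ^ j) + fps_nth_deriv (p ^ 1) S * S ^ j)) 0 =
      of_int (int p * 1 * w)"
    unfolding egf_dvd_def by blast
  moreover have "fps_nth (S ^ j) 0 = 0" using j S_0 by simp
  ultimately have "fact p * fps_nth (S ^ i) p = of_int (int p * w)"
    using j(1) fact_mult_nth_deriv[of 0 p "S ^ i"] by (simp add: S_0)
  moreover have "fact p * fps_nth (S ^ i) p = of_int (fact i * b)"
    using b by (simp add: field_simps)
  ultimately have "fact i * b = int p * w" by (metis of_int_eq_iff)
  hence "int p dvd fact i * b" by simp
  moreover have "\<not> int p dvd fact i"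
    using p i by (metis int_dvd_int_iff not_less of_nat_fact prime_dvd_fact_iff)
  ultimately have "int p dvd b" using p by (simp add: prime_dvd_mult_iff)
  then obtain z where "b = int p * z" by blast
  with b show ?thesis by (intro that[of z]) simp
qed

lemma fact_mult_a_egf_deriv:
  "fact n * fps_nth (fps_nth_deriv k a_egf) n = of_int (a (n + k))"
  by (simp only: fact_mult_nth_deriv of_int_a)

lemma divisor_series_integral: "egf_dvd 1 divisor_series"
proof (rule egf_dvdI)
  show "fact n * fps_nth divisor_series n =
      of_int (1 * (if n = 0 then 0 else fact (n - 1) * int (num_divisors n)))" for n
    by (cases n) (simp_all add: divisor_series_def del: of_nat_Suc)
qed

interpretation a_egf: integral_log_deriv a_egf "fps_deriv divisor_series"
proof
  show "fps_nth (fps_deriv divisor_series) n \<in> \<int>" for n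
    by (simp add: divisor_series_def del: of_nat_Suc)
  show "egf_dvd 1 a_egf"
    by (rule egf_dvdI[of _ _ a]) (simp add: of_int_a)
qed (simp_all add: deriv_a_egf)

lemma a_shift_cong_iff:
  "egf_dvd m (fps_nth_deriv k a_egf - of_int c * a_egf) \<longleftrightarrow> (\<forall>n. m dvd a (n + k) - c * a n)"
proof -
  have "fact n * fps_nth (fps_nth_deriv k a_egf - of_int c * a_egf) n =
      of_int (a (n + k) - c * a n)" for n
    by (simp add: fact_mult_a_egf_deriv right_diff_distrib of_int_a)
  thus ?thesis unfolding egf_dvd_def by (simp only: of_int_eq_iff dvd_def)
qed

lemma a_shift_cong: "int k dvd a (n + k) - a k * a n"
  using a_egf.nth_deriv_cong[of k "a k"] by (simp add: a_shift_cong_iff of_int_a)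

lemma num_divisors_prime: "prime p \<Longrightarrow> num_divisors p = 2"
proof -
  assume p: "prime p"
  hence "{d. d dvd p} = {1, p}" by (auto simp: prime_nat_iff)
  thus ?thesis using p by (simp add: num_divisors_def prime_nat_iff)
qed

text \<open>Write \<open>a(p)\<close> as the sum over \<open>i\<close> of \<open>p!\<close> times the \<open>p\<close>-th coefficient of \<open>S^i / i!\<close>. The terms with
  \<open>1 < i < p\<close> are divisible by \<open>p\<close>. The term \<open>i = p\<close> is 1, from \<open>x^p / p!\<close>, and the term \<open>i = 1\<close> is
  \<open>d(p) * (p - 1)!\<close>, which is congruent to \<open>-2\<close> by Wilson's theorem. In terms of permutations
  of \<open>p\<close> elements, these are the identity, of weight 1, and the \<open>p\<close>-cycles, of weight 2.\<close>

lemma a_prime_cong: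
  assumes p: "prime p" "odd p"
  shows "int p dvd a p + 1"
proof -
  let ?S = divisor_series
  have "2 < p" using p prime_ge_2_nat[of p] by (cases "p = 2") auto
  define t where "t i = fact p * fps_nth (?S ^ i) p / fact i" for i
  have "\<forall>i\<in>{2..<p}. \<exists>z. t i = of_int (int p * z)"
  proof
    fix i assume "i \<in> {2..<p}"
    hence i: "2 \<le> i" "i < p" by auto
    obtain z where "t i = of_int (int p * z)"
      unfolding t_def
      by (rule prime_dvd_divided_power_coeff[OF p(1) i divisor_series_integral
            divisor_series_nth_0])
    thus "\<exists>z. t i = of_int (int p * z)" ..
  qed
  then obtain z where z: "\<forall>i\<in>{2..<p}. t i = of_int (int p * z i)"
    by (rule bchoice[THEN exE])
  have t_0: "t 0 = 0" using \<open>2 < p\<close> by (simp add: t_def)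
  have t_1: "t 1 = of_int (2 * fact (p - 1))"
    using \<open>2 < p\<close> p(1)
    by (simp add: t_def divisor_series_def num_divisors_prime fact_reduce[of p])
  have t_p: "t p = 1"
    by (simp add: t_def startsby_zero_power_nth_same)
      (simp add: divisor_series_def num_divisors_def)
  have "of_int (a p) = fact p * fps_nth a_egf p" by (rule of_int_a)
  also have "\<dots> = (\<Sum>i=0..p. fact p * (fps_nth (fps_exp 1) i * fps_nth (?S ^ i) p))"
    by (simp only: a_egf_def fps_compose_nth sum_distrib_left)
  also have "\<dots> = (\<Sum>i=0..p. t i)"
    by (simp add: t_def)
  also have "{0..p} = insert 0 (insert 1 (insert p {2..<p}))"
    using \<open>2 < p\<close> by auto
  also have "(\<Sum>i\<in>\<dots>. t i) = of_int (2 * fact (p - 1) + 1 + int p * (\<Sum>i=2..<p. z i))"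
    using \<open>2 < p\<close> z t_0 t_1 t_p by (simp add: sum_distrib_left)
  finally have "a p = 2 * fact (p - 1) + 1 + int p * (\<Sum>i=2..<p. z i)"
    by (simp only: of_int_eq_iff)
  hence "a p + 1 = 2 * (fact (p - 1) + 1) + int p * (\<Sum>i=2..<p. z i)"
    by simp
  moreover have "int p dvd fact (p - 1) + 1"
    using wilson_theorem[OF p(1)] by (simp add: cong_iff_dvd_diff)
  ultimately show ?thesis by (simp only: dvd_add dvd_mult dvd_triv_left)
qed

lemma a_rec:
  "a (Suc n) = (\<Sum>j\<le>n. int (num_divisors (Suc j) * (fact n div fact (n - j))) * a (n - j))"
proof -
  have "of_int (a (Suc n)) = (of_int (\<Sum>j\<le>n. int (num_divisors (Suc j) *
      (fact n div fact (n - j))) * a (n - j)) :: rat)"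
    unfolding of_int_a a_egf_fact_rec of_int_sum of_int_mult of_int_of_nat_eq ..
  thus ?thesis by (simp only: of_int_eq_iff)
qed

lemma num_divisors_eq_length:
  assumes "m > 0"
  shows "num_divisors m = length (filter (\<lambda>d. d dvd m) [1..<Suc m])"
proof -
  have "{d. d dvd m} = set (filter (\<lambda>d. d dvd m) [1..<Suc m])"
    using assms by (auto simp: less_Suc_eq_le dvd_imp_le intro: Nat.gr0I)
  thus ?thesis unfolding num_divisors_def
    by (simp only: distinct_card distinct_filter distinct_upt)
qed

lemma a_2: "a 2 = 3" and a_8: "a 8 = 202089"
proof -
  have d: "num_divisors 1 = 1" "num_divisors 2 = 2" "num_divisors 3 = 2" "num_divisors 4 = 3"
    "num_divisors 5 = 2" "num_divisors 6 = 4" "num_divisors 7 = 2" "num_divisors 8 = 4"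
    by (subst num_divisors_eq_length, simp, code_simp)+
  have "num_divisors (Suc 0) = 1" "num_divisors (Suc (Suc 0)) = 2"
    using d(1,2) by (simp_all add: numeral_2_eq_2)
  note simps = atMost_nat_numeral fact_numeral d this
  have a0: "a 0 = 1" by (simp add: a_def)
  have a1: "a 1 = 1" using a_rec[of 0] d(1) by (simp add: a0)
  note simps = simps a1[unfolded One_nat_def]
  have a2: "a 2 = 3" using a_rec[of 1] d(2) by (simp add: simps a0 a1 numeral_2_eq_2)
  have a3: "a 3 = 11" using a_rec[of 2] by (simp add: simps a0 a1 a2)
  have a4: "a 4 = 59" using a_rec[of 3] by (simp add: simps a0 a1 a2 a3)
  have a5: "a 5 = 339" using a_rec[of 4] by (simp add: simps a0 a1 a2 a3 a4)
  have a6: "a 6 = 2629" using a_rec[of 5] by (simp add: simps a0 a1 a2 a3 a4 a5)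
  have a7: "a 7 = 20677" using a_rec[of 6] by (simp add: simps a0 a1 a2 a3 a4 a5 a6)
  show "a 2 = 3" by (rule a2)
  show "a 8 = 202089" using a_rec[of 7] by (simp add: simps a0 a1 a2 a3 a4 a5 a6 a7)
qed

section \<open>Shifts by prime powers and by arbitrary integers\<close>

lemma a_shift_odd_prime_power:
  assumes p: "prime p" "odd p"
  shows "int (p ^ Suc e) dvd a (n + p ^ Suc e) + a n"
proof -
  have "egf_dvd (int (p ^ Suc e)) (fps_nth_deriv (p ^ Suc e) a_egf - of_int (- 1) * a_egf)"
  proof (induction e)
    case 0
    have "int p dvd (a (n + p) - a p * a n) + (a p + 1) * a n" for n
      by (intro dvd_add a_shift_cong dvd_mult2 a_prime_cong p)
    hence "\<forall>n. int p dvd a (n + p) - (- 1) * a n"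
      by (simp add: algebra_simps)
    hence "egf_dvd (int p) (fps_nth_deriv p a_egf - of_int (- 1) * a_egf)"
      by (simp only: a_shift_cong_iff simp_thms)
    thus ?case by simp
  next
    case (Suc e)
    have "egf_dvd (int (p * p ^ Suc e))
        (fps_nth_deriv (p * p ^ Suc e) a_egf - of_int ((- 1) ^ p) * a_egf)"
      by (rule a_egf.nth_deriv_cong_lift[OF p(1) _ _ _ Suc]) (use p in simp_all)
    thus ?case using p by simp
  qed
  hence "int (p ^ Suc e) dvd a (n + p ^ Suc e) - (- 1) * a n"
    by (simp only: a_shift_cong_iff simp_thms)
  thus ?thesis by simp
qed

lemma a_shift_power_2:
  assumes "e \<ge> 3"
  shows "int (2 ^ e) dvd a (n + 2 ^ e) - a n"
proof -
  have "egf_dvd (int (2 ^ e)) (fps_nth_deriv (2 ^ e) a_egf - of_int 1 * a_egf)"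
    using assms
  proof (induction e rule: dec_induct)
    case base
    \<comment> \<open>\<open>a 8 = 202089 = 8 * 25261 + 1\<close>\<close>
    have "8 dvd (a (n + 8) - a 8 * a n) + 8 * (25261 * a n)" for n
      using a_shift_cong[of 8 n] by (intro dvd_add) simp_all
    hence "\<forall>n. int 8 dvd a (n + 8) - 1 * a n"
      by (simp add: a_8)
    hence "egf_dvd (int 8) (fps_nth_deriv 8 a_egf - of_int 1 * a_egf)"
      by (simp only: a_shift_cong_iff simp_thms)
    thus ?case by simp
  next
    case (step e)
    have "4 \<le> (2 ^ e :: nat)"
      using power_increasing[of 2 e "2 :: nat"] step.hyps by simp
    hence "egf_dvd (int (2 * 2 ^ e))
        (fps_nth_deriv (2 * 2 ^ e) a_egf - of_int (1 ^ 2) * a_egf)"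
      by (intro a_egf.nth_deriv_cong_lift[OF _ _ _ _ step.IH]) (use step.hyps in simp_all)
    thus ?case by simp
  qed
  hence "int (2 ^ e) dvd a (n + 2 ^ e) - 1 * a n"
    by (simp only: a_shift_cong_iff simp_thms)
  thus ?thesis by simp
qed

lemma a_shift_2: "2 dvd a (n + 2) - a n"
proof -
  have "2 dvd (a (n + 2) - a 2 * a n) + 2 * a n"
    using a_shift_cong[of 2 n] by (intro dvd_add) simp_all
  thus ?thesis by (simp add: a_2)
qed

lemma dvd_shift_iterate:
  fixes f :: "nat \<Rightarrow> 'a :: comm_ring_1"
  assumes "\<And>n. d dvd f (n + q) - c * f n"
  shows "d dvd f (n + q * m) - c ^ m * f n"
proof (induction m)
  case (Suc m)
  have "d dvd (f ((n + q * m) + q) - c * f (n + q * m)) + c * (f (n + q * m) - c ^ m * f n)"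
    by (intro dvd_add assms dvd_mult Suc)
  thus ?case by (simp add: algebra_simps)
qed simp

lemma int_dvd_if_prime_powers_dvd:
  assumes "k > 0" "\<And>p. prime p \<Longrightarrow> p dvd k \<Longrightarrow> int (p ^ multiplicity p k) dvd x"
  shows "int k dvd x"
proof -
  have "k dvd nat \<bar>x\<bar>"
  proof (cases "x = 0")
    case False
    show ?thesis
    proof (rule multiplicity_le_imp_dvd)
      fix p :: nat assume p: "prime p"
      show "multiplicity p k \<le> multiplicity p (nat \<bar>x\<bar>)"
      proof (cases "p dvd k")
        case True
        hence "p ^ multiplicity p k dvd nat \<bar>x\<bar>"
          using assms(2)[OF p] by (simp add: dvd_nat_abs_iff)
        thus ?thesis
          using p False by (intro multiplicity_geI) auto
      qed (simp add: not_dvd_imp_multiplicity_0)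
    qed (use assms in auto)
  qed simp
  thus ?thesis by (simp add: dvd_nat_abs_iff)
qed

lemma a_shift_odd_prime_component:
  assumes p: "prime p" "odd p" "p dvd k" and k: "k > 0"
  shows "int (p ^ multiplicity p k) dvd a (n + k) - (- 1) ^ k * a n"
proof -
  let ?q = "p ^ multiplicity p k"
  obtain m where m: "k = ?q * m" using multiplicity_dvd[of p k] by blast
  have "multiplicity p k > 0"
    using p k by (simp add: prime_multiplicity_gt_zero_iff)
  then obtain e where e: "multiplicity p k = Suc e" by (cases "multiplicity p k") auto
  have "int ?q dvd a (n + ?q * m) - (- 1) ^ m * a n"
    using a_shift_odd_prime_power[OF p(1,2), of e] unfolding e
    by (intro dvd_shift_iterate) simp
  moreover have "(- 1 :: int) ^ m = (- 1) ^ k"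
    using p(2) arg_cong[OF m, of even] by (simp add: minus_one_power_iff)
  ultimately show ?thesis using m by simp
qed

theorem theorem1p1:
  fixes n k :: nat
  assumes "k \<ge> 1"
  shows "(odd k \<longrightarrow> int k dvd a (n + k) + a n) \<and>
         (k mod 8 \<in> {0, 2, 6} \<longrightarrow> int k dvd a (n + k) - a n) \<and>
         (k mod 8 = 4 \<longrightarrow> int k dvd 2 * (a (n + k) - a n))"
proof -
  have k: "k > 0" using assms by simp
  let ?e = "multiplicity 2 k"
  have odd_part: "int (p ^ multiplicity p k) dvd a (n + k) - a n"
    if "even k" "prime p" "p dvd k" "p \<noteq> 2" for p
  proof -
    have "odd p" using that prime_odd_nat[of p] prime_ge_2_nat[of p] by auto
    thus ?thesis using a_shift_odd_prime_component[of p k n] that k by simp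
  qed
  have parity: "2 dvd a (n + k) - a n" if "even k"
    using dvd_shift_iterate[of 2 a 2 1 n "k div 2"] a_shift_2 that by simp
  have two_part: "int (2 ^ ?e) dvd a (n + k) - a n" if "?e \<ge> 3"
  proof -
    obtain m where m: "k = 2 ^ ?e * m" using multiplicity_dvd[of 2 k] by blast
    have "int (2 ^ ?e) dvd a (n + 2 ^ ?e * m) - 1 ^ m * a n"
      using a_shift_power_2[OF that] by (intro dvd_shift_iterate) simp
    thus ?thesis using m by simp
  qed
  have e_less: "?e < 3" if "k mod 8 \<noteq> 0"
  proof (rule ccontr)
    assume "\<not> ?e < 3"
    hence "2 ^ 3 dvd k" using multiplicity_dvd' by (meson not_less)
    with that show False by auto
  qed
  show ?thesis
  proof (intro conjI impI)
    assume odd: "odd k"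
    show "int k dvd a (n + k) + a n"
    proof (rule int_dvd_if_prime_powers_dvd[OF k])
      fix p assume p: "prime p" "p dvd k"
      have "odd p" using p odd by (meson dvd_trans)
      thus "int (p ^ multiplicity p k) dvd a (n + k) + a n"
        using a_shift_odd_prime_component[of p k n] p odd k by simp
    qed
  next
    assume mod: "k mod 8 \<in> {0, 2, 6}"
    hence residues: "k mod 8 = 0 \<or> k mod 8 = 2 \<or> k mod 8 = 6" by simp
    hence even: "even k" by presburger
    show "int k dvd a (n + k) - a n"
    proof (rule int_dvd_if_prime_powers_dvd[OF k])
      fix p assume p: "prime p" "p dvd k"
      consider "p \<noteq> 2" | "p = 2" "?e \<ge> 3" | "p = 2" "?e < 3" by linarith
      thus "int (p ^ multiplicity p k) dvd a (n + k) - a n"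
      proof cases
        case 3
        have "?e \<noteq> 2"
        proof
          assume "?e = 2"
          hence "4 dvd k" "\<not> 8 dvd k"
            using multiplicity_dvd[of 2 k] multiplicity_geI[of k 2 3] k by auto
          with residues show False by presburger
        qed
        hence "2 ^ ?e dvd (2 :: int)" using 3 by (auto simp: less_Suc_eq numeral_3_eq_3)
        thus ?thesis using parity[OF even] 3(1) dvd_trans by force
      qed (use odd_part[OF even p] two_part in auto)
    qed
  next
    assume mod: "k mod 8 = 4"
    hence even: "even k" by presburger
    show "int k dvd 2 * (a (n + k) - a n)"
    proof (rule int_dvd_if_prime_powers_dvd[OF k])
      fix p assume p: "prime p" "p dvd k"
      show "int (p ^ multiplicity p k) dvd 2 * (a (n + k) - a n)"
      proof (cases "p = 2")
        case True
        have "?e \<le> 2" using e_less mod by simp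
        hence "2 ^ ?e dvd (2 ^ 2 :: int)" by (rule le_imp_power_dvd)
        moreover have "2 ^ 2 dvd 2 * (a (n + k) - a n)"
          using mult_dvd_mono[OF dvd_refl[of 2] parity[OF even]] by simp
        ultimately show ?thesis using True dvd_trans by force
      qed (intro dvd_mult odd_part even p)
    qed
  qed
qed

end
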